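(* There exists a sequence of real constants $(C_k)_{k\geqslant 0}$ with $C_k=\mathrm{O}(k)$ as $k\to\infty$ such that the following holds: for every fixed $k\geqslant 0$ and all sufficiently small $u>0$ (how small may depend on $k$), the relative error $\eta_k = (\tilde b_k-b_k)/b_k$ of the value $\tilde b_k$ of the scaled Bernoulli number $b_k$ computed with unit roundoff $u$ satisfies $|\eta_k|\leqslant C_k u$. The constants $C_k$ do not depend on $u$.
   Context: The scaled Bernoulli numbers are $b_k = B_{2k}/(2k)!$, $k\geqslant 0$, where $B_j$ are the classical Bernoulli numbers. They satisfy the recurrence $$b_k = \frac{1}{(2k)!\,4^k} - \sum_{j=0}^{k-1}\frac{b_j}{(2k+1-2j)!\,4^{k-j}},\qquad k\geqslant 0. \quad ( * )$$ Floating-point model (binary, unbounded exponents, unit roundoff $u$): the computed result of each elementary operation $x\ast y$, $\ast\in\{+,-,\times,/\}$, equals $(x\ast y)(1+\delta)$ for some $|\delta|\leqslant u$, and also equals $(x\ast y)(1+\delta')^{-1}$ for some $|\delta'|\leqslant u$; multiplications by powers of two are exact. One writes $\eta=\theta_n$ to mean that $1+\eta=\prod_{i=1}^n(1+\delta_i)$ for some $\delta_1,\dots,\delta_n$ with $|\delta_i|\leqslant u$. The sequence $(\tilde b_k)$ denotes the approximations of $(b_k)$ computed by evaluating $( * )$ iteratively in this model, with previously computed values $\tilde b_j$ in place of $b_j$. It is assumed that the computed value of $n!$ is $n!/(1+q_n)$ with $q_n=\theta_{n-2}$ for $n\geqslant 2$ and $q_0=q_1=0$. The value $\tilde b_0=1$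 is exact. For $k\geqslant 1$, the term $1/((2k)!4^k)$ is obtained by computing $(2k)!$, multiplying by $4^k$ (exact) and inverting; the $j$-th term of the sum is obtained by computing $(2k+1-2j)!$, multiplying by $4^{k-j}$ (exact), inverting, and multiplying by $\tilde b_j$; the terms of the sum are added successively for $j=0,1,\dots,k-1$ to the running partial sum; finally the sum is subtracted from the first term. The statement holds for all individual rounding errors allowed by the model. *)

theory Defs
  imports "HOL-Computational_Algebra.Formal_Power_Series" "HOL-Library.Landau_Symbols"
begin

text \<open>The Bernoulli numbers, by their exponential generating function \<open>x / (exp x - 1)\<close>.\<close>

definition bernoulli :: "nat \<Rightarrow> real" where
  "bernoulli n = fact n * fps_nth (fps_X / (fps_exp 1 - 1)) n"

definition scaled_bernoulli :: "nat \<Rightarrow> real" where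
  "scaled_bernoulli k = bernoulli (2 * k) / fact (2 * k)"

text \<open>\<open>rounded u x y\<close>: with unit roundoff \<open>u\<close>, an elementary operation whose exact result is \<open>x\<close>
  may return \<open>y\<close>. Only \<open>u < 1\<close> is meaningful, so that \<open>1 + \<delta>\<close> cannot vanish.\<close>

definition rounded :: "real \<Rightarrow> real \<Rightarrow> real \<Rightarrow> bool" where
  "rounded u x y \<longleftrightarrow>
     (\<exists>\<delta>. \<bar>\<delta>\<bar> \<le> u \<and> y = x * (1 + \<delta>)) \<and> (\<exists>\<delta>. \<bar>\<delta>\<bar> \<le> u \<and> y = x * inverse (1 + \<delta>))"

text \<open>\<open>is_theta u n \<eta>\<close> is the relation usually written \<open>\<eta> = \<theta>\<^sub>n\<close>.\<close>

definition is_theta :: "real \<Rightarrow> nat \<Rightarrow> real \<Rightarrow> bool" where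
  "is_theta u n \<eta> \<longleftrightarrow>
     (\<exists>\<delta> :: nat \<Rightarrow> real. (\<forall>i\<in>{1..n}. \<bar>\<delta> i\<bar> \<le> u) \<and> 1 + \<eta> = (\<Prod>i=1..n. 1 + \<delta> i))"

definition computed_factorials :: "real \<Rightarrow> (nat \<Rightarrow> real) \<Rightarrow> bool" where
  "computed_factorials u F \<longleftrightarrow>
     (\<exists>q. q 0 = 0 \<and> q 1 = 0 \<and> (\<forall>n\<ge>2. is_theta u (n - 2) (q n)) \<and>
          (\<forall>n. F n = fact n / (1 + q n)))"

text \<open>\<open>computed_step u F b k y\<close>: from the computed factorials \<open>F\<close> and the computed values
  \<open>b 0, \<dots>, b (k - 1)\<close>, evaluating
  \<open>1 / ((2k)! 4^k) - (\<Sum>j<k. b j / ((2k + 1 - 2j)! 4^(k-j)))\<close> may return \<open>y\<close>.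
  Here \<open>a\<close> is the first term, \<open>r j\<close> and \<open>p j\<close> are the reciprocal and the product in the
  \<open>j\<close>-th term of the sum, and \<open>s j\<close> is the partial sum of the first \<open>j\<close> terms. Multiplications by
  powers of 4 are exact; each of the \<open>k\<close> additions, including the first one \<open>0 + p 0\<close>, is allowed
  a rounding error.\<close>

definition computed_step ::
    "real \<Rightarrow> (nat \<Rightarrow> real) \<Rightarrow> (nat \<Rightarrow> real) \<Rightarrow> nat \<Rightarrow> real \<Rightarrow> bool" where
  "computed_step u F b k y \<longleftrightarrow>
     (\<exists>a r p s.
        rounded u (1 / (F (2 * k) * 4 ^ k)) a \<and>
        (\<forall>j<k. rounded u (1 / (F (2 * k + 1 - 2 * j) * 4 ^ (k - j))) (r j)) \<and>
        (\<forall>j<k. rounded u (r j * b j) (p j)) \<and>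
        s 0 = 0 \<and>
        (\<forall>j<k. rounded u (s j + p j) (s (Suc j))) \<and>
        rounded u (a - s k) y)"

definition computed_scaled_bernoulli :: "real \<Rightarrow> (nat \<Rightarrow> real) \<Rightarrow> bool" where
  "computed_scaled_bernoulli u b \<longleftrightarrow>
     (\<exists>F. computed_factorials u F \<and> b 0 = 1 \<and> (\<forall>k\<ge>1. computed_step u F b k (b k)))"

end

theory Submission
  imports Defs "HOL-Analysis.Complex_Transcendental"
begin

text \<open>
  Rescale by \<open>D k = (- 4 \<pi>\<^sup>2) ^ k * b k\<close>. In terms of formal power series in \<open>t\<close> the recurrence then
  reads \<open>S * D = H\<close>, where \<open>S\<close> and \<open>H\<close> are the series of \<open>sin x / x\<close> and \<open>cos x\<close> in
  \<open>t = x\<^sup>2 / \<pi>\<^sup>2\<close>, so that \<open>D\<close> is the series of \<open>x cot x\<close>. The first zero of the sine, \<open>x = \<pi>\<close>,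
  sits at \<open>t = 1\<close>, and everything follows from the fact that this is the only zero of \<open>S\<close> in the
  closed unit disc and that it is simple. Quantitatively, \<open>S = (1 - t) * W\<close>, where \<open>W = 1 - Q\<close> and
  the absolute values of the coefficients of \<open>Q\<close> sum to less than 1. By the Neumann
  series \<open>1 / W\<close> has absolutely summable coefficients, hence dividing by \<open>S\<close> amounts to taking
  partial sums (division by \<open>1 - t\<close>) followed by convolution with an absolutely summable sequence
  (\<open>sinc_fps_quotient\<close>).

  There are two consequences. The numbers \<open>D k\<close> are the partial sums of \<open>H / W\<close>, so they
  converge to \<open>cos \<pi> / W(1) = - 1 / W(1)\<close>, which is not zero (\<open>rescaled_bernoulli_tendsto\<close>). Secondly, if
  \<open>S * E = L\<close> and \<open>\<bar>L i\<bar> \<le> d\<close> for all \<open>i \<le> n\<close>, then \<open>\<bar>E n\<bar> \<le> A * (n + 1) * d\<close> with a constant \<open>A\<close>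
  (\<open>sinc_fps_quotient_le\<close>). It is this partial summation that produces the factor \<open>k\<close>.

  Let \<open>E\<close> be the rescaled absolute error. Then \<open>L = S * E\<close> consists of the rounding errors
  committed in the individual steps. In step \<open>n\<close> the first term carries \<open>2 * n\<close> rounding errors and
  the \<open>j\<close>-th summand carries at most \<open>3 * (n - j) + 2\<close> of them. The latter
  number depends only on the distance \<open>n - j\<close>, and the coefficient \<open>S (n - j)\<close> decays factorially in
  this distance, so \<open>\<bar>L n\<bar>\<close> is bounded by a constant times \<open>u\<close>, uniformly in \<open>n\<close>, as long
  as the rescaled computed values stay bounded (\<open>rescaled_residual_le\<close>). For fixed \<open>k\<close> and small \<open>u\<close>
  they do: by induction each of them differs by at most 1 from the bounded sequence \<open>D\<close>. Thus
  \<open>\<bar>E k\<bar> \<le> K * (k + 1) * u\<close>, and dividing by \<open>\<bar>D k\<bar>\<close>, which is bounded away from zero for large \<open>k\<close>,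
  yields the relative error.
\<close>

unbundle no vec_syntax
unbundle fps_syntax

section \<open>The recurrence for the exact numbers\<close>

text \<open>
  Multiplying \<open>B * (exp x - 1) = x\<close> by \<open>exp (- x / 2)\<close> gives \<open>B * 2 sinh (x / 2) = x * exp (- x / 2)\<close>.
  In the coefficient of \<open>x ^ (2 * k + 1)\<close> only the even-indexed coefficients of \<open>B\<close> meet a nonzero
  coefficient of the odd function \<open>sinh\<close>.
\<close>

lemma scaled_bernoulli_recurrence:
  "(\<Sum>j\<le>k. scaled_bernoulli j / (fact (2 * k + 1 - 2 * j) * 4 ^ (k - j))) = 1 / (fact (2 * k) * 4 ^ k)"
proof -
  define B :: "real fps" where "B = fps_X / (fps_exp 1 - 1)"
  define sh :: "real fps" where "sh = fps_exp (1/2) - fps_exp (-1/2)"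
  have sd: "subdegree (fps_exp 1 - 1 :: real fps) = 1"
    by (rule subdegreeI) auto
  have nz: "fps_exp 1 - 1 \<noteq> (0 :: real fps)"
    using sd by auto
  have "(fps_exp 1 - 1 :: real fps) dvd fps_X"
    using nz sd by (subst fps_dvd_iff) auto
  then have BX: "B * (fps_exp 1 - 1) = fps_X"
    unfolding B_def by simp
  have "fps_exp (-1/2) * (fps_exp 1 - 1) = sh"
    unfolding sh_def using fps_exp_add_mult[of "-1/2 :: real" 1]
    by (simp add: algebra_simps)
  then have "B * sh = fps_X * fps_exp (-1/2)"
    using BX by (metis mult.assoc mult.commute)
  then have "fps_nth (B * sh) (2 * k + 1) = fps_nth (fps_exp (-1/2)) (2 * k)"
    by simp
  then have *: "(\<Sum>i=0..2 * k + 1. fps_nth B i * fps_nth sh (2 * k + 1 - i)) = 1 / (fact (2 * k) * 4 ^ k)"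
    by (simp add: fps_mult_nth power_mult power_divide)
  have "(\<Sum>i=0..2 * k + 1. fps_nth B i * fps_nth sh (2 * k + 1 - i)) =
        (\<Sum>i\<in>(\<lambda>j. 2 * j) ` {..k}. fps_nth B i * fps_nth sh (2 * k + 1 - i))"
  proof (rule sum.mono_neutral_right)
    show "\<forall>i\<in>{0..2 * k + 1} - (\<lambda>j. 2 * j) ` {..k}. fps_nth B i * fps_nth sh (2 * k + 1 - i) = 0"
    proof
      fix i assume i: "i \<in> {0..2 * k + 1} - (\<lambda>j. 2 * j) ` {..k}"
      have "odd i"
      proof
        assume "even i"
        then obtain j where "i = 2 * j" by blast
        with i show False by auto
      qed
      then have "even (2 * k + 1 - i)"
        using i by auto
      then show "fps_nth B i * fps_nth sh (2 * k + 1 - i) = 0"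
        by (simp add: sh_def)
    qed
  qed auto
  also have "\<dots> = (\<Sum>j\<le>k. fps_nth B (2 * j) * fps_nth sh (2 * k + 1 - 2 * j))"
    by (subst sum.reindex) (auto simp: inj_on_def)
  also have "\<dots> = (\<Sum>j\<le>k. scaled_bernoulli j / (fact (2 * k + 1 - 2 * j) * 4 ^ (k - j)))"
  proof (rule sum.cong)
    fix j assume "j \<in> {..k}"
    then have e: "2 * k + 1 - 2 * j = Suc (2 * (k - j))" by auto
    have "fps_nth sh (2 * k + 1 - 2 * j) = 1 / (fact (2 * k + 1 - 2 * j) * 4 ^ (k - j))"
    proof -
      have "(4::real) ^ (k - j) = 2 ^ (2 * (k - j))"
        by (simp add: power_mult)
      then show ?thesis
        unfolding e sh_def by (simp add: power_divide power_minus_odd field_simps del: fact_Suc)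
    qed
    then show "fps_nth B (2 * j) * fps_nth sh (2 * k + 1 - 2 * j) =
          scaled_bernoulli j / (fact (2 * k + 1 - 2 * j) * 4 ^ (k - j))"
      by (simp add: scaled_bernoulli_def bernoulli_def B_def)
  qed simp
  finally show ?thesis using * by simp
qed

section \<open>Power series with absolutely summable coefficients\<close>

lemma sum_abs_fps_mult_le:
  fixes f g :: "real fps"
  shows "(\<Sum>n\<le>N. \<bar>(f * g) $ n\<bar>) \<le> (\<Sum>n\<le>N. \<bar>f $ n\<bar>) * (\<Sum>n\<le>N. \<bar>g $ n\<bar>)"
proof -
  have "(\<Sum>n\<le>N. \<bar>(f * g) $ n\<bar>) \<le> (\<Sum>n\<le>N. \<Sum>i\<le>n. \<bar>f $ i\<bar> * \<bar>g $ (n - i)\<bar>)"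
    unfolding fps_mult_nth atLeast0AtMost
    by (intro sum_mono order_trans[OF sum_abs]) (simp add: abs_mult)
  also have "\<dots> = (\<Sum>(i, j)\<in>{(i, j). i + j \<le> N}. \<bar>f $ i\<bar> * \<bar>g $ j\<bar>)"
    by (rule sum.triangle_reindex_eq[symmetric])
  also have "\<dots> \<le> (\<Sum>(i, j)\<in>{..N} \<times> {..N}. \<bar>f $ i\<bar> * \<bar>g $ j\<bar>)"
    by (rule sum_mono2) auto
  also have "\<dots> = (\<Sum>n\<le>N. \<bar>f $ n\<bar>) * (\<Sum>n\<le>N. \<bar>g $ n\<bar>)"
    by (simp add: sum_product sum.cartesian_product)
  finally show ?thesis .
qed

lemma fps_mult_sums:
  fixes f g :: "real fps"
  assumes "summable (\<lambda>n. \<bar>f $ n\<bar>)" "summable (\<lambda>n. \<bar>g $ n\<bar>)"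
  shows "(\<lambda>n. (f * g) $ n) sums ((\<Sum>n. f $ n) * (\<Sum>n. g $ n))"
  using Cauchy_product_sums[of "fps_nth f" "fps_nth g"] assms
  by (simp add: fps_mult_nth atLeast0AtMost)

text \<open>
  The Neumann series in the Banach algebra of absolutely summable sequences. Instead of summing powers of
  \<open>1 - f\<close>, take norms in the fixed-point equation \<open>1 / f = 1 + (1 - f) * (1 / f)\<close>: the truncated
  norm \<open>v\<close> of \<open>1 / f\<close> satisfies \<open>v \<le> 1 + q * v\<close>.
\<close>

lemma summable_abs_inverse_fps:
  fixes f :: "real fps"
  assumes f0: "f $ 0 = 1" and q: "q < 1" and tail: "\<And>N. (\<Sum>n=1..N. \<bar>f $ n\<bar>) \<le> q"
  shows "summable (\<lambda>n. \<bar>inverse f $ n\<bar>)"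
proof (rule summableI_nonneg_bounded)
  fix N
  define v where "v = (\<Sum>n\<le>N. \<bar>inverse f $ n\<bar>)"
  have eq: "inverse f = 1 + (1 - f) * inverse f"
    using f0 inverse_mult_eq_1[of f] by (simp add: algebra_simps)
  have "v = (\<Sum>n\<le>N. \<bar>(1 + (1 - f) * inverse f) $ n\<bar>)"
    unfolding v_def using eq by simp
  also have "\<dots> \<le> (\<Sum>n\<le>N. \<bar>(1 :: real fps) $ n\<bar> + \<bar>((1 - f) * inverse f) $ n\<bar>)"
    by (intro sum_mono) (simp only: fps_add_nth abs_triangle_ineq)
  also have "\<dots> = 1 + (\<Sum>n\<le>N. \<bar>((1 - f) * inverse f) $ n\<bar>)"
  proof -
    have "(\<Sum>n\<le>N. \<bar>(1 :: real fps) $ n\<bar>) = (\<Sum>n\<le>N. if n = 0 then 1 else 0)"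
      by (rule sum.cong) auto
    then show ?thesis by (simp add: sum.distrib)
  qed
  also have "(\<Sum>n\<le>N. \<bar>((1 - f) * inverse f) $ n\<bar>) \<le> (\<Sum>n\<le>N. \<bar>(1 - f) $ n\<bar>) * v"
    unfolding v_def by (rule sum_abs_fps_mult_le)
  also have "(\<Sum>n\<le>N. \<bar>(1 - f) $ n\<bar>) = (\<Sum>n=1..N. \<bar>f $ n\<bar>)"
    by (rule sum.mono_neutral_cong_right) (auto simp: f0 not_le)
  also have "\<dots> * v \<le> q * v"
    by (intro mult_right_mono tail) (simp add: v_def sum_nonneg)
  finally have "v \<le> 1 / (1 - q)"
    using q by (simp add: field_simps)
  then show "(\<Sum>n<N. \<bar>inverse f $ n\<bar>) \<le> 1 / (1 - q)"
    unfolding v_def by (rule order_trans[rotated]) (rule sum_mono2, auto)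
qed simp

section \<open>The sine and cosine series at the first zero of the sine\<close>

text \<open>
  The series of \<open>sin x / x\<close> and \<open>cos x\<close> in the variable \<open>x\<^sup>2 / \<pi>\<^sup>2\<close>, which moves the zero at
  \<open>x = \<pi>\<close> to the point 1.
\<close>

definition sinc_fps :: "real fps" where
  "sinc_fps = Abs_fps (\<lambda>m. (- (pi\<^sup>2)) ^ m / fact (2 * m + 1))"

definition cos_fps :: "real fps" where
  "cos_fps = Abs_fps (\<lambda>m. (- (pi\<^sup>2)) ^ m / fact (2 * m))"

text \<open>
  The series of \<open>sin x / (x * (1 - x\<^sup>2 / \<pi>\<^sup>2))\<close>: dividing by \<open>1 - t\<close> is taking partial sums.
\<close>

definition sinc_cofactor :: "real fps" where
  "sinc_cofactor = Abs_fps (\<lambda>n. \<Sum>i=0..n. sinc_fps $ i)"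

lemma sinc_fps_factor: "sinc_fps = (1 - fps_X) * sinc_cofactor"
  unfolding sinc_cofactor_def by (rule fps_divide_fps_X_minus1_sum_lemma)

lemma sinc_fps_sums: "(\<lambda>m. sinc_fps $ m) sums 0"
proof -
  have "(\<lambda>m. inverse pi * ((- 1) ^ m / fact (2 * m + 1) * pi ^ (2 * m + 1))) sums (inverse pi * sin pi)"
    by (rule sums_mult[OF sin_paired])
  moreover have "inverse pi * ((- 1) ^ m / fact (2 * m + 1) * pi ^ (2 * m + 1)) = sinc_fps $ m" for m
    unfolding sinc_fps_def fps_nth_Abs_fps power_minus[of "pi\<^sup>2"]
    by (simp add: field_simps del: fact_Suc flip: power_mult)
  ultimately show ?thesis by simp
qed

lemma cos_fps_sums: "(\<lambda>m. cos_fps $ m) sums (- 1)"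
proof -
  have "(- 1) ^ m / fact (2 * m) * pi ^ (2 * m) = cos_fps $ m" for m
    unfolding cos_fps_def fps_nth_Abs_fps power_minus[of "pi\<^sup>2"] by (simp add: power_mult)
  then show ?thesis using cos_paired[of pi] by simp
qed

lemma summable_abs_cos_fps: "summable (\<lambda>m. \<bar>cos_fps $ m\<bar>)"
proof (rule summable_comparison_test')
  show "summable (\<lambda>m. inverse (fact m) * (pi\<^sup>2) ^ m)"
    by (rule summable_exp)
  fix m :: nat
  have "fact m \<le> (fact (2 * m) :: real)" by (rule fact_mono) simp
  then show "norm \<bar>cos_fps $ m\<bar> \<le> inverse (fact m) * (pi\<^sup>2) ^ m"
    by (simp add: cos_fps_def abs_mult power_abs field_simps)
qed

lemma pi_square_le: "pi\<^sup>2 \<le> 10"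
proof -
  have "pi \<le> 3.15" using pi_approx(2) by simp
  then have "pi\<^sup>2 \<le> 3.15\<^sup>2" by (intro power_mono) auto
  also have "(3.15::real)\<^sup>2 \<le> 10" by (simp add: power2_eq_square)
  finally show ?thesis .
qed

text \<open>
  In absolute value, the coefficient of index 3 is at most \<open>10 ^ 3 / 7! = 25 / 126\<close>, and from there on each quotient of
  consecutive coefficients is at most \<open>10 / (8 * 9) = 5 / 36\<close>.
\<close>

lemma abs_sinc_fps_le: "\<bar>sinc_fps $ (i + 3)\<bar> \<le> 25 / 126 * (5 / 36) ^ i"
proof (induction i)
  case 0
  have "(pi\<^sup>2) ^ 3 \<le> 10 ^ 3" by (intro power_mono pi_square_le) auto
  then show ?case by (simp add: sinc_fps_def power_abs fact_numeral)
next
  case (Suc i)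
  define c :: real where "c = (2 * real i + 8) * (2 * real i + 9)"
  have c: "c \<ge> 72"
    unfolding c_def using mult_mono[of 8 "2 * real i + 8" 9 "2 * real i + 9"] by simp
  have f: "fact (2 * (Suc i + 3) + 1) = c * (fact (2 * (i + 3) + 1) :: real)"
  proof -
    have "2 * (Suc i + 3) + 1 = Suc (Suc (2 * (i + 3) + 1))" by simp
    then show ?thesis unfolding c_def
      by (simp only: fact_Suc of_nat_mult of_nat_Suc of_nat_add of_nat_numeral mult.assoc[symmetric])
         (simp add: algebra_simps)
  qed
  have "\<bar>sinc_fps $ (Suc i + 3)\<bar> = pi\<^sup>2 / c * \<bar>sinc_fps $ (i + 3)\<bar>"
    unfolding sinc_fps_def fps_nth_Abs_fps f using c
    by (simp add: abs_mult power_abs power_add del: fact_Suc)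
  also have "\<dots> \<le> (5 / 36) * (25 / 126 * (5 / 36) ^ i)"
  proof (intro mult_mono Suc)
    have "pi\<^sup>2 / c \<le> 10 / 72" using c pi_square_le by (intro frac_le) auto
    then show "pi\<^sup>2 / c \<le> 5 / 36" by simp
  qed auto
  finally show ?case by simp
qed

text \<open>
  The coefficients of \<open>sin x / x\<close> sum to \<open>sin \<pi> / \<pi> = 0\<close>, so a partial sum is minus the tail, which is
  dominated by a geometric series.
\<close>

lemma abs_sinc_cofactor_le: "\<bar>sinc_cofactor $ (n + 2)\<bar> \<le> 50 / 217 * (5 / 36) ^ n"
proof -
  have *: "(\<lambda>i. 25 / 126 * (5 / 36) ^ n * (5 / 36) ^ i) sums
           (25 / 126 * (5 / 36) ^ n * (1 / (1 - 5 / 36 :: real)))"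
    by (intro sums_mult geometric_sums) simp
  have le: "\<bar>sinc_fps $ (i + (n + 3))\<bar> \<le> 25 / 126 * (5 / 36) ^ n * (5 / 36) ^ i" for i
    using abs_sinc_fps_le[of "i + n"] by (simp add: power_add add.assoc mult_ac)
  have sum: "summable (\<lambda>i. \<bar>sinc_fps $ (i + (n + 3))\<bar>)"
    by (rule summable_comparison_test'[OF sums_summable[OF *]]) (use le in simp)
  have "0 = (\<Sum>i. sinc_fps $ (i + (n + 3))) + (\<Sum>i<n + 3. sinc_fps $ i)"
    using suminf_split_initial_segment[of "fps_nth sinc_fps" "n + 3"] sinc_fps_sums
    by (simp add: sums_iff)
  moreover have "(\<Sum>i<n + 3. sinc_fps $ i) = sinc_cofactor $ (n + 2)"
    unfolding sinc_cofactor_def fps_nth_Abs_fps by (rule sum.cong) auto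
  ultimately have "\<bar>sinc_cofactor $ (n + 2)\<bar> = \<bar>\<Sum>i. sinc_fps $ (i + (n + 3))\<bar>"
    by linarith
  also have "\<dots> \<le> (\<Sum>i. \<bar>sinc_fps $ (i + (n + 3))\<bar>)"
    using summable_norm[of "\<lambda>i. sinc_fps $ (i + (n + 3))"] sum by simp
  also have "\<dots> \<le> (\<Sum>i. 25 / 126 * (5 / 36) ^ n * (5 / 36) ^ i)"
    by (rule suminf_le[OF le sum sums_summable[OF *]])
  also have "\<dots> = 50 / 217 * (5 / 36) ^ n"
    using * by (simp add: sums_iff)
  finally show ?thesis .
qed

text \<open>
  This makes the Neumann series applicable. The coefficient of index 1 has to be taken exactly, as
  \<open>1 - \<pi>\<^sup>2 / 6\<close>: bounding it by the absolute values of its tail would push the total above 1.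
\<close>

lemma sum_abs_sinc_cofactor_le: "(\<Sum>n=1..N. \<bar>sinc_cofactor $ n\<bar>) \<le> 19 / 20"
proof -
  have "(\<Sum>n=1..N. \<bar>sinc_cofactor $ n\<bar>) \<le> (\<Sum>n=1..N + 1. \<bar>sinc_cofactor $ n\<bar>)"
    by (rule sum_mono2) auto
  also have "\<dots> = \<bar>sinc_cofactor $ 1\<bar> + (\<Sum>n=2..N + 1. \<bar>sinc_cofactor $ n\<bar>)"
    by (subst sum.atLeast_Suc_atMost) (auto simp: numeral_2_eq_2)
  also have "(\<Sum>n=2..N + 1. \<bar>sinc_cofactor $ n\<bar>) = (\<Sum>n<N. \<bar>sinc_cofactor $ (n + 2)\<bar>)"
    by (rule sum.reindex_bij_witness[of _ "\<lambda>n. n + 2" "\<lambda>n. n - 2"])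
       (auto simp: le_add_diff_inverse2 simp del: add_2_eq_Suc')
  also have "\<bar>sinc_cofactor $ 1\<bar> \<le> 2 / 3"
  proof -
    have "3\<^sup>2 \<le> pi\<^sup>2" using pi_gt3 by (intro power_mono) auto
    moreover have "sinc_cofactor $ 1 = 1 - pi\<^sup>2 / 6"
      by (simp add: sinc_cofactor_def sinc_fps_def fact_numeral)
    ultimately show ?thesis using pi_square_le by simp
  qed
  also have "(\<Sum>n<N. \<bar>sinc_cofactor $ (n + 2)\<bar>) \<le> (\<Sum>n<N. 50 / 217 * (5 / 36) ^ n)"
    by (intro sum_mono abs_sinc_cofactor_le)
  also have "\<dots> \<le> (\<Sum>n. 50 / 217 * (5 / 36) ^ n)"
    by (rule sum_le_suminf) (auto intro!: summable_mult summable_geometric)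
  also have "(\<Sum>n. 50 / 217 * (5 / 36 :: real) ^ n) = 50 / 217 * (1 / (1 - 5 / 36))"
    by (subst suminf_mult) (auto simp: suminf_geometric)
  finally show ?thesis by simp
qed

lemma sinc_cofactor_0: "sinc_cofactor $ 0 = 1"
  by (simp add: sinc_cofactor_def sinc_fps_def)

lemma summable_abs_inverse_sinc_cofactor: "summable (\<lambda>n. \<bar>inverse sinc_cofactor $ n\<bar>)"
  by (rule summable_abs_inverse_fps[of _ "19 / 20"])
     (use sum_abs_sinc_cofactor_le sinc_cofactor_0 in auto)

text \<open>
  Convergence at the point 1 is absolute for both factors, so the identity \<open>(1 / W) * W = 1\<close> may be
  evaluated there.
\<close>

lemma suminf_inverse_sinc_cofactor_nz: "(\<Sum>n. inverse sinc_cofactor $ n) \<noteq> 0"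
proof -
  have "summable (\<lambda>n. \<bar>sinc_cofactor $ (n + 2)\<bar>)"
    by (rule summable_comparison_test'[of "\<lambda>n. 50 / 217 * (5 / 36) ^ n"])
       (use abs_sinc_cofactor_le in \<open>auto intro!: summable_mult summable_geometric\<close>)
  then have "summable (\<lambda>n. \<bar>sinc_cofactor $ n\<bar>)"
    by (subst (asm) summable_iff_shift)
  then have "(\<lambda>n. (inverse sinc_cofactor * sinc_cofactor) $ n) sums
      ((\<Sum>n. inverse sinc_cofactor $ n) * (\<Sum>n. sinc_cofactor $ n))"
    by (intro fps_mult_sums summable_abs_inverse_sinc_cofactor)
  moreover have "inverse sinc_cofactor * sinc_cofactor = 1"
    by (rule inverse_mult_eq_1) (simp add: sinc_cofactor_0)
  moreover have "(\<lambda>n. (1 :: real fps) $ n) sums 1"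
    using sums_single[of 0 "\<lambda>_. 1 :: real"] by (simp add: eq_commute)
  ultimately have "(\<Sum>n. inverse sinc_cofactor $ n) * (\<Sum>n. sinc_cofactor $ n) = 1"
    using sums_unique2 by fastforce
  then show ?thesis by auto
qed

lemma sinc_fps_quotient:
  assumes "sinc_fps * g = h"
  shows "g = inverse sinc_cofactor * Abs_fps (\<lambda>n. \<Sum>i=0..n. h $ i)"
proof -
  have "(1 - fps_X) * (sinc_cofactor * g) = (1 - fps_X) * Abs_fps (\<lambda>n. \<Sum>i=0..n. h $ i)"
    using assms fps_divide_fps_X_minus1_sum_lemma[of h]
    by (simp add: sinc_fps_factor mult.assoc)
  moreover have "(1 - fps_X :: real fps) \<noteq> 0"
    by (auto simp: fps_eq_iff intro!: exI[of _ 0])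
  ultimately have "sinc_cofactor * g = Abs_fps (\<lambda>n. \<Sum>i=0..n. h $ i)"
    by simp
  then have "inverse sinc_cofactor * sinc_cofactor * g =
      inverse sinc_cofactor * Abs_fps (\<lambda>n. \<Sum>i=0..n. h $ i)"
    by (simp add: mult.assoc)
  then show ?thesis
    using inverse_mult_eq_1[of sinc_cofactor] sinc_cofactor_0 by simp
qed

text \<open>
  Stability of the recurrence: a perturbation of size \<open>d\<close> in every step up to \<open>n\<close> causes an error that grows
  only linearly in \<open>n\<close>. The growth comes from the simple zero of \<open>sin x / x\<close> at \<open>x = \<pi>\<close>.
\<close>

lemma sinc_fps_quotient_le:
  assumes h: "\<And>i. i \<le> n \<Longrightarrow> \<bar>(sinc_fps * g) $ i\<bar> \<le> d"
  shows "\<bar>g $ n\<bar> \<le> (\<Sum>i. \<bar>inverse sinc_cofactor $ i\<bar>) * ((real n + 1) * d)"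
proof -
  define P where "P = Abs_fps (\<lambda>n. \<Sum>i=0..n. (sinc_fps * g) $ i)"
  have d: "0 \<le> d" using h[of n] by linarith
  have P: "\<bar>P $ i\<bar> \<le> (real n + 1) * d" if "i \<le> n" for i
  proof -
    have "\<bar>P $ i\<bar> \<le> (\<Sum>j=0..i. \<bar>(sinc_fps * g) $ j\<bar>)"
      unfolding P_def by simp
    also have "\<dots> \<le> (\<Sum>j=0..i. d)"
      using h that by (intro sum_mono) auto
    also have "\<dots> \<le> (real n + 1) * d"
      using that d by (auto intro!: mult_right_mono)
    finally show ?thesis .
  qed
  have "g $ n = (inverse sinc_cofactor * P) $ n"
    unfolding P_def using sinc_fps_quotient[OF refl, of g] by simp
  also have "\<bar>\<dots>\<bar> \<le> (\<Sum>i=0..n. \<bar>inverse sinc_cofactor $ i\<bar> * \<bar>P $ (n - i)\<bar>)"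
    unfolding fps_mult_nth by (rule order_trans[OF sum_abs]) (simp add: abs_mult)
  also have "\<dots> \<le> (\<Sum>i=0..n. \<bar>inverse sinc_cofactor $ i\<bar> * ((real n + 1) * d))"
    by (intro sum_mono mult_left_mono P) auto
  also have "\<dots> = (\<Sum>i=0..n. \<bar>inverse sinc_cofactor $ i\<bar>) * ((real n + 1) * d)"
    by (simp add: sum_distrib_right)
  also have "\<dots> \<le> (\<Sum>i. \<bar>inverse sinc_cofactor $ i\<bar>) * ((real n + 1) * d)"
    using d by (intro mult_right_mono sum_le_suminf summable_abs_inverse_sinc_cofactor) auto
  finally show ?thesis .
qed

section \<open>Asymptotics of the scaled Bernoulli numbers\<close>

text \<open>
  The left-hand side of the recurrence, for an arbitrary sequence \<open>x\<close> in place of the exact numbers: it is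
  applied to them and to the errors of the computed ones.
\<close>

lemma sinc_fps_mult_rescaled:
  "(sinc_fps * Abs_fps (\<lambda>j. (- 4 * pi\<^sup>2) ^ j * x j)) $ n =
     (- 4 * pi\<^sup>2) ^ n * (\<Sum>j\<le>n. x j / (fact (2 * n + 1 - 2 * j) * 4 ^ (n - j)))"
proof -
  have "(sinc_fps * Abs_fps (\<lambda>j. (- 4 * pi\<^sup>2) ^ j * x j)) $ n =
      (\<Sum>j\<le>n. (- 4 * pi\<^sup>2) ^ j * x j * sinc_fps $ (n - j))"
    by (subst mult.commute) (simp add: fps_mult_nth atLeast0AtMost)
  also have "\<dots> = (\<Sum>j\<le>n. (- 4 * pi\<^sup>2) ^ n * (x j / (fact (2 * n + 1 - 2 * j) * 4 ^ (n - j))))"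
  proof (rule sum.cong)
    fix j assume "j \<in> {..n}"
    then obtain m where n: "n = j + m" using le_Suc_ex by blast
    have e: "2 * (j + m) + 1 - 2 * j = 2 * m + 1" by simp
    have "(- 4 * pi\<^sup>2) ^ m = 4 ^ m * (- (pi\<^sup>2)) ^ m"
      by (simp flip: power_mult_distrib)
    then show "(- 4 * pi\<^sup>2) ^ j * x j * sinc_fps $ (n - j) =
        (- 4 * pi\<^sup>2) ^ n * (x j / (fact (2 * n + 1 - 2 * j) * 4 ^ (n - j)))"
      unfolding n e by (simp add: sinc_fps_def power_add del: fact_Suc)
  qed simp
  finally show ?thesis by (simp add: sum_distrib_left)
qed

lemma rescaled_bernoulli_tendsto:
  "(\<lambda>k. (- 4 * pi\<^sup>2) ^ k * scaled_bernoulli k) \<longlonglongrightarrow> - (\<Sum>n. inverse sinc_cofactor $ n)"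
proof -
  define g where "g = Abs_fps (\<lambda>k. (- 4 * pi\<^sup>2) ^ k * scaled_bernoulli k)"
  have "sinc_fps * g = cos_fps"
  proof (rule fps_ext)
    fix n
    have "(- 4 * pi\<^sup>2) ^ n = 4 ^ n * (- (pi\<^sup>2)) ^ n"
      by (simp flip: power_mult_distrib)
    then show "(sinc_fps * g) $ n = cos_fps $ n"
      unfolding g_def sinc_fps_mult_rescaled scaled_bernoulli_recurrence
      by (simp add: cos_fps_def)
  qed
  then have "g = inverse sinc_cofactor * (cos_fps / (1 - fps_X))"
    unfolding fps_divide_fps_X_minus1_sum by (rule sinc_fps_quotient)
  also have "\<dots> = inverse sinc_cofactor * (cos_fps * inverse (1 - fps_X))"
    by (simp add: fps_divide_unit)
  also have "\<dots> = inverse sinc_cofactor * cos_fps / (1 - fps_X)"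
    by (simp add: fps_divide_unit mult.assoc)
  finally have g: "g $ k = (\<Sum>i\<le>k. (inverse sinc_cofactor * cos_fps) $ i)" for k
    by (simp add: fps_divide_fps_X_minus1_sum atLeast0AtMost)
  have "(\<lambda>n. (inverse sinc_cofactor * cos_fps) $ n) sums
      ((\<Sum>n. inverse sinc_cofactor $ n) * (\<Sum>n. cos_fps $ n))"
    by (intro fps_mult_sums summable_abs_inverse_sinc_cofactor summable_abs_cos_fps)
  then have "(\<lambda>k. g $ k) \<longlonglongrightarrow> (\<Sum>n. inverse sinc_cofactor $ n) * (\<Sum>n. cos_fps $ n)"
    unfolding g sums_def_le .
  then show ?thesis
    using cos_fps_sums by (simp add: g_def sums_iff)
qed

section \<open>Rounding errors in one step of the recurrence\<close>

text \<open>
  A running error bound in which rounding is multiplicative. Think of \<open>t\<close> as a signed sum of exact terms,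
  of \<open>T\<close> as the sum of their absolute values and of \<open>M\<close> as the same sum with each absolute value
  multiplied by a factor \<open>(1 + u) ^ N\<close>, where \<open>N\<close> counts the rounding errors that the term has
  undergone. A further rounding multiplies \<open>M\<close> by \<open>1 + u\<close>, and sums and differences
  add the \<open>T\<close> and the \<open>M\<close>, so cancellation in \<open>t\<close> needs no special treatment.
\<close>

definition approximates :: "real \<Rightarrow> real \<Rightarrow> real \<Rightarrow> real \<Rightarrow> bool" where
  "approximates x t T M \<longleftrightarrow> \<bar>t\<bar> \<le> T \<and> \<bar>x - t\<bar> \<le> M - T"

text \<open>
  The computed \<open>x\<close> has absolute value at most \<open>T + (M - T) = M\<close>, so the new error is at most \<open>M * u\<close>.
\<close>

lemma approximates_rounded:
  assumes "approximates x t T M" "rounded u x y"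
  shows "approximates y t T (M * (1 + u))"
proof -
  obtain d where d: "\<bar>d\<bar> \<le> u" "y = x * (1 + d)"
    using assms(2) by (auto simp: rounded_def)
  have a: "\<bar>t\<bar> \<le> T" "\<bar>x - t\<bar> \<le> M - T" using assms(1) by (auto simp: approximates_def)
  have "\<bar>x\<bar> \<le> M" using a by linarith
  then have "\<bar>x * d\<bar> \<le> M * u" unfolding abs_mult using d by (intro mult_mono) auto
  then show ?thesis using a d unfolding approximates_def by (simp add: algebra_simps)
qed

lemma approximates_add:
  "approximates x t T M \<Longrightarrow> approximates x' t' T' M' \<Longrightarrow> approximates (x + x') (t + t') (T + T') (M + M')"
  unfolding approximates_def by linarith

lemma approximates_diff:
  "approximates x t T M \<Longrightarrow> approximates x' t' T' M' \<Longrightarrow> approximates (x - x') (t - t') (T + T') (M + M')"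
  unfolding approximates_def by linarith

lemma approximates_mult_right:
  assumes "approximates x t T M"
  shows "approximates (x * c) (t * c) (T * \<bar>c\<bar>) (M * \<bar>c\<bar>)"
proof -
  have "\<bar>t\<bar> * \<bar>c\<bar> \<le> T * \<bar>c\<bar>" "\<bar>x - t\<bar> * \<bar>c\<bar> \<le> (M - T) * \<bar>c\<bar>"
    using assms by (auto simp: approximates_def intro!: mult_right_mono)
  then show ?thesis
    unfolding approximates_def by (simp add: abs_mult left_diff_distrib flip: abs_mult)
qed

lemma is_theta_abs_le:
  assumes "is_theta u n \<eta>"
  shows "\<bar>\<eta>\<bar> \<le> (1 + u) ^ n - 1"
proof -
  obtain d :: "nat \<Rightarrow> real" where d: "\<forall>i\<in>{1..n}. \<bar>d i\<bar> \<le> u" "1 + \<eta> = (\<Prod>i=1..n. 1 + d i)"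
    using assms by (auto simp: is_theta_def)
  have "approximates (\<Prod>i=1..m. 1 + d i) 1 1 ((1 + u) ^ m)" if "m \<le> n" for m
    using that
  proof (induction m)
    case (Suc m)
    define P where "P = (\<Prod>i=1..m. 1 + d i)"
    have P: "\<bar>P - 1\<bar> \<le> (1 + u) ^ m - 1" using Suc by (simp add: approximates_def P_def)
    have "\<bar>d (Suc m)\<bar> \<le> u" using d(1) Suc.prems by auto
    moreover have "\<bar>P\<bar> \<le> (1 + u) ^ m" using P by linarith
    ultimately have "\<bar>P * d (Suc m)\<bar> \<le> (1 + u) ^ m * u"
      unfolding abs_mult by (intro mult_mono) auto
    moreover have "(\<Prod>i=1..Suc m. 1 + d i) = P + P * d (Suc m)"
      by (simp add: P_def distrib_left)
    ultimately show ?case using P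
      unfolding approximates_def by (simp add: algebra_simps)
  qed (simp add: approximates_def)
  from this[of n] show ?thesis using d(2) by (simp add: approximates_def flip: d(2))
qed

lemma approximates_inverse_factorial:
  assumes "computed_factorials u F" "2 \<le> m"
  shows "approximates (1 / (F m * 4 ^ i)) (1 / (fact m * 4 ^ i)) (1 / (fact m * 4 ^ i))
           (1 / (fact m * 4 ^ i) * (1 + u) ^ (m - 2))"
proof -
  obtain q where "is_theta u (m - 2) (q m)" "F m = fact m / (1 + q m)"
    using assms unfolding computed_factorials_def by blast
  then have q: "\<bar>q m\<bar> \<le> (1 + u) ^ (m - 2) - 1" and F: "F m = fact m / (1 + q m)"
    by (auto intro: is_theta_abs_le)
  have "1 / (F m * 4 ^ i) - 1 / (fact m * 4 ^ i) = 1 / (fact m * 4 ^ i) * q m"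
    unfolding F by (cases "1 + q m = 0") (auto simp: field_simps)
  then have "\<bar>1 / (F m * 4 ^ i) - 1 / (fact m * 4 ^ i)\<bar> = 1 / (fact m * 4 ^ i) * \<bar>q m\<bar>"
    by (simp add: abs_mult)
  also have "\<dots> \<le> 1 / (fact m * 4 ^ i) * ((1 + u) ^ (m - 2) - 1)"
    using q by (intro mult_left_mono) auto
  finally show ?thesis
    unfolding approximates_def by (simp add: right_diff_distrib)
qed

text \<open>
  Counting rounding errors. The first term suffers \<open>2 * n - 2\<close> errors from the factorial, one from the
  inversion and one from the final subtraction. For the \<open>j\<close>-th summand there are \<open>2 * (n - j) - 1\<close> from the
  factorial, one each from inversion, multiplication and the final subtraction, and \<open>n - j\<close>
  from the additions in which it takes part.
\<close>

lemma computed_step_approximates: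
  assumes F: "computed_factorials u F" and step: "computed_step u F b n y" and n: "1 \<le> n"
  defines "c \<equiv> \<lambda>j. 1 / (fact (2 * n + 1 - 2 * j) * 4 ^ (n - j))"
  shows "approximates y (1 / (fact (2 * n) * 4 ^ n) - (\<Sum>j<n. c j * b j))
           (1 / (fact (2 * n) * 4 ^ n) + (\<Sum>j<n. c j * \<bar>b j\<bar>))
           (1 / (fact (2 * n) * 4 ^ n) * (1 + u) ^ (2 * n)
              + (\<Sum>j<n. c j * \<bar>b j\<bar> * (1 + u) ^ (3 * (n - j) + 2)))"
proof -
  obtain a r p s where a: "rounded u (1 / (F (2 * n) * 4 ^ n)) a"
    and r: "\<And>j. j < n \<Longrightarrow> rounded u (1 / (F (2 * n + 1 - 2 * j) * 4 ^ (n - j))) (r j)"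
    and p: "\<And>j. j < n \<Longrightarrow> rounded u (r j * b j) (p j)"
    and s0: "s 0 = 0"
    and s: "\<And>j. j < n \<Longrightarrow> rounded u (s j + p j) (s (Suc j))"
    and y: "rounded u (a - s n) y"
    using step unfolding computed_step_def by blast
  define a0 :: real where "a0 = 1 / (fact (2 * n) * 4 ^ n)"
  have A: "approximates a a0 a0 (a0 * (1 + u) ^ (2 * n - 2) * (1 + u))"
    unfolding a0_def by (rule approximates_rounded[OF approximates_inverse_factorial[OF F] a]) (use n in auto)
  have P: "approximates (p j) (c j * b j) (c j * \<bar>b j\<bar>) (c j * \<bar>b j\<bar> * (1 + u) ^ (2 * (n - j) + 1))"
    if j: "j < n" for j
  proof -
    have "2 \<le> 2 * n + 1 - 2 * j" using j by simp
    note R = approximates_rounded[OF approximates_inverse_factorial[OF F this] r[OF j]]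
    from approximates_rounded[OF approximates_mult_right[OF R, of "b j"] p[OF j]]
    have "approximates (p j) (c j * b j) (c j * \<bar>b j\<bar>)
        (c j * (1 + u) ^ (2 * n + 1 - 2 * j - 2) * (1 + u) * \<bar>b j\<bar> * (1 + u))"
      unfolding c_def .
    moreover have "2 * (n - j) + 1 = Suc (Suc (2 * n + 1 - 2 * j - 2))"
      using j by simp
    ultimately show ?thesis by (simp only: power_Suc mult_ac)
  qed
  have "approximates (s m) (\<Sum>j<m. c j * b j) (\<Sum>j<m. c j * \<bar>b j\<bar>)
      (\<Sum>j<m. c j * \<bar>b j\<bar> * (1 + u) ^ (2 * (n - j) + 1 + (m - j)))" if "m \<le> n" for m
    using that
  proof (induction m)
    case 0
    then show ?case using s0 by (simp add: approximates_def)
  next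
    case (Suc m)
    then have m: "m < n" by simp
    have IH: "approximates (s m) (\<Sum>j<m. c j * b j) (\<Sum>j<m. c j * \<bar>b j\<bar>)
      (\<Sum>j<m. c j * \<bar>b j\<bar> * (1 + u) ^ (2 * (n - j) + 1 + (m - j)))"
      using Suc by simp
    have eq: "((\<Sum>j<m. c j * \<bar>b j\<bar> * (1 + u) ^ (2 * (n - j) + 1 + (m - j)))
            + c m * \<bar>b m\<bar> * (1 + u) ^ (2 * (n - m) + 1)) * (1 + u)
        = (\<Sum>j<Suc m. c j * \<bar>b j\<bar> * (1 + u) ^ (2 * (n - j) + 1 + (Suc m - j)))"
      unfolding sum.lessThan_Suc distrib_right sum_distrib_right
      by (intro arg_cong2[where f = "(+)"] sum.cong) (auto simp: Suc_diff_le mult_ac)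
    show ?case
      using approximates_rounded[OF approximates_add[OF IH P[OF m]] s[OF m]]
      unfolding eq by simp
  qed
  from approximates_rounded[OF approximates_diff[OF A this[OF order_refl]] y]
  have *: "approximates y (a0 - (\<Sum>j<n. c j * b j)) (a0 + (\<Sum>j<n. c j * \<bar>b j\<bar>))
     ((a0 * (1 + u) ^ (2 * n - 2) * (1 + u) +
      (\<Sum>j<n. c j * \<bar>b j\<bar> * (1 + u) ^ (2 * (n - j) + 1 + (n - j)))) * (1 + u))" .
  have "a0 * (1 + u) ^ (2 * n - 2) * (1 + u) * (1 + u) = a0 * (1 + u) ^ (Suc (Suc (2 * n - 2)))"
    by simp
  also have "Suc (Suc (2 * n - 2)) = 2 * n" using n by simp
  finally have "(a0 * (1 + u) ^ (2 * n - 2) * (1 + u) +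
      (\<Sum>j<n. c j * \<bar>b j\<bar> * (1 + u) ^ (2 * (n - j) + 1 + (n - j)))) * (1 + u) =
     a0 * (1 + u) ^ (2 * n) + (\<Sum>j<n. c j * \<bar>b j\<bar> * (1 + u) ^ (3 * (n - j) + 2))"
    unfolding distrib_right sum_distrib_right
    by (intro arg_cong2[where f = "(+)"] sum.cong) (auto simp: algebra_simps power_add power2_eq_square)
  with * show ?thesis unfolding a0_def by simp
qed

section \<open>Propagation of the errors\<close>

lemma power_one_plus_le:
  fixes u :: real
  assumes "0 \<le> u" "real N * u \<le> 1"
  shows "(1 + u) ^ N - 1 \<le> 2 * u * real N"
proof -
  define x where "x = real N * u"
  have x: "0 \<le> x" "x \<le> 1" using assms by (auto simp: x_def)
  have "(1 + u) ^ N \<le> exp u ^ N"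
    using assms by (intro power_mono) (auto simp: exp_ge_add_one_self)
  also have "\<dots> = exp x" by (simp add: x_def exp_of_nat_mult)
  also have "\<dots> \<le> 1 + x + x\<^sup>2" using x by (intro exp_bound)
  also have "x\<^sup>2 \<le> x" using x by (simp add: power2_eq_square mult_left_le)
  finally show ?thesis by (simp add: x_def mult_ac)
qed

lemma abs_sinc_fps_cos_fps: "real (2 * m + 1) * \<bar>sinc_fps $ m\<bar> = \<bar>cos_fps $ m\<bar>"
proof -
  define r where "r = real (2 * m + 1)"
  have r: "0 < r" "(fact (2 * m + 1) :: real) = r * fact (2 * m)"
    by (simp_all add: r_def algebra_simps)
  then have "r * \<bar>sinc_fps $ m\<bar> = \<bar>cos_fps $ m\<bar>"
    unfolding sinc_fps_def cos_fps_def fps_nth_Abs_fps r(2)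
    by (simp add: abs_mult)
  then show ?thesis by (simp add: r_def)
qed

text \<open>
  The weight \<open>2 * n\<close>, the number of rounding errors in the first term, cancels a factor of the factorial.
\<close>

lemma abs_cos_fps_mult_le: "real (2 * n) * \<bar>cos_fps $ n\<bar> \<le> pi\<^sup>2 * (\<Sum>m. \<bar>cos_fps $ m\<bar>)"
proof (cases n)
  case 0
  then show ?thesis by (simp add: suminf_nonneg summable_abs_cos_fps)
next
  case (Suc m)
  define r where "r = real (2 * Suc m)"
  have r: "0 < r" "(fact (2 * Suc m) :: real) = r * fact (2 * m + 1)"
    by (simp_all add: r_def algebra_simps)
  then have "r * \<bar>cos_fps $ Suc m\<bar> = pi\<^sup>2 * \<bar>sinc_fps $ m\<bar>"
    unfolding cos_fps_def sinc_fps_def fps_nth_Abs_fps r(2)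
    by (simp add: abs_mult power_abs del: fact_Suc)
  then have "real (2 * Suc m) * \<bar>cos_fps $ Suc m\<bar> = pi\<^sup>2 * \<bar>sinc_fps $ m\<bar>"
    by (simp only: r_def)
  also have "\<bar>sinc_fps $ m\<bar> \<le> real (2 * m + 1) * \<bar>sinc_fps $ m\<bar>"
    using mult_right_mono[of 1 "real (2 * m + 1)" "\<bar>sinc_fps $ m\<bar>"] by simp
  also have "\<dots> = \<bar>cos_fps $ m\<bar>" by (rule abs_sinc_fps_cos_fps)
  also have "\<dots> \<le> (\<Sum>m. \<bar>cos_fps $ m\<bar>)"
    using sum_le_suminf[OF summable_abs_cos_fps, of "{m}"] by simp
  finally show ?thesis using Suc by simp
qed

text \<open>
  The error introduced by one step is at most a multiple of \<open>u\<close> in which \<open>n\<close> enters only through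
  \<open>M\<close>: the number of errors \<open>3 * (n - j) + 2 \<le> 2 * (2 * (n - j) + 1)\<close> in the \<open>j\<close>-th summand is absorbed by
  turning a coefficient of \<open>sin x / x\<close> into one of \<open>cos x\<close>, and the latter are absolutely summable.
\<close>

lemma rescaled_residual_le:
  assumes F: "computed_factorials u F" and step: "computed_step u F b n (b n)" and n: "1 \<le> n"
    and u: "0 \<le> u" "real (5 * n) * u \<le> 1"
    and M: "\<And>j. j < n \<Longrightarrow> \<bar>(- 4 * pi\<^sup>2) ^ j * b j\<bar> \<le> M"
  shows "\<bar>(sinc_fps * Abs_fps (\<lambda>j. (- 4 * pi\<^sup>2) ^ j * (b j - scaled_bernoulli j))) $ n\<bar>
           \<le> 2 * (pi\<^sup>2 + 2 * M) * (\<Sum>m. \<bar>cos_fps $ m\<bar>) * u"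
proof -
  define c :: "nat \<Rightarrow> real" where "c = (\<lambda>j. 1 / (fact (2 * n + 1 - 2 * j) * 4 ^ (n - j)))"
  define a :: real where "a = 1 / (fact (2 * n) * 4 ^ n)"
  define G where "G = (\<Sum>m. \<bar>cos_fps $ m\<bar>)"
  define w :: real where "w = (4 * pi\<^sup>2) ^ n"
  have c0: "0 \<le> c j" for j by (simp add: c_def)
  have "0 \<le> M" using M[of 0] n by linarith
  \<comment> \<open>As \<open>1 \<le> n\<close>, all error counts of the step, \<open>2 * n\<close> and \<open>3 * (n - j) + 2\<close>, are at most \<open>5 * n\<close>.\<close>
  have growth: "(1 + u) ^ N - 1 \<le> 2 * u * real N" if "N \<le> 5 * n" for N
  proof (rule power_one_plus_le[OF u(1)])
    have "real N * u \<le> real (5 * n) * u" using that u(1) by (intro mult_right_mono) auto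
    then show "real N * u \<le> 1" using u(2) by linarith
  qed
  have first: "w * (a * real (2 * n)) \<le> pi\<^sup>2 * G"
  proof -
    have "w * a = \<bar>cos_fps $ n\<bar>"
      unfolding w_def a_def cos_fps_def by (simp add: power_abs power_mult_distrib)
    then have "w * (a * real (2 * n)) = real (2 * n) * \<bar>cos_fps $ n\<bar>"
      by (metis mult.assoc mult.commute)
    then show ?thesis using abs_cos_fps_mult_le[of n] by (simp only: G_def)
  qed
  have summand: "w * (c j * \<bar>b j\<bar> * real (3 * (n - j) + 2)) \<le> 2 * M * \<bar>cos_fps $ (n - j)\<bar>"
    if j: "j < n" for j
  proof -
    obtain m where nm: "n = j + m" using j le_Suc_ex less_imp_le by blast
    have e: "2 * n + 1 - 2 * j = 2 * m + 1" "n - j = m" using nm by auto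
    have "w * (c j * \<bar>b j\<bar>) = \<bar>sinc_fps $ m\<bar> * \<bar>(- 4 * pi\<^sup>2) ^ j * b j\<bar>"
      unfolding c_def w_def e sinc_fps_def nm
      by (simp add: power_add power_abs abs_mult power_mult_distrib del: fact_Suc)
    also have "\<dots> * real (3 * (n - j) + 2) \<le> \<bar>sinc_fps $ m\<bar> * M * real (2 * (2 * m + 1))"
      using e M[OF j] \<open>0 \<le> M\<close> by (intro mult_mono mult_nonneg_nonneg) auto
    also have "\<dots> = 2 * M * (real (2 * m + 1) * \<bar>sinc_fps $ m\<bar>)" by simp
    also have "\<dots> = 2 * M * \<bar>cos_fps $ (n - j)\<bar>" unfolding abs_sinc_fps_cos_fps e ..
    finally show ?thesis by (simp add: mult_ac)
  qed
  have "(\<Sum>j<n. \<bar>cos_fps $ (n - j)\<bar>) = (\<Sum>m\<in>{1..n}. \<bar>cos_fps $ m\<bar>)"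
    by (rule sum.reindex_bij_witness[of _ "\<lambda>m. n - m" "\<lambda>j. n - j"]) auto
  also have "\<dots> \<le> G"
    unfolding G_def by (intro sum_le_suminf summable_abs_cos_fps) auto
  finally have cosG: "(\<Sum>j<n. \<bar>cos_fps $ (n - j)\<bar>) \<le> G" .
  have rec: "(\<Sum>j<n. c j * scaled_bernoulli j) + scaled_bernoulli n = a"
    using scaled_bernoulli_recurrence[of n]
    by (simp add: lessThan_Suc_atMost[symmetric] a_def c_def)
  have "(sinc_fps * Abs_fps (\<lambda>j. (- 4 * pi\<^sup>2) ^ j * (b j - scaled_bernoulli j))) $ n =
      (- 4 * pi\<^sup>2) ^ n * ((\<Sum>j<n. c j * (b j - scaled_bernoulli j)) + (b n - scaled_bernoulli n))"
    unfolding sinc_fps_mult_rescaled by (simp add: lessThan_Suc_atMost[symmetric] c_def)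
  also have "(\<Sum>j<n. c j * (b j - scaled_bernoulli j)) + (b n - scaled_bernoulli n) =
      b n - (a - (\<Sum>j<n. c j * b j))"
    using rec by (simp add: right_diff_distrib sum_subtractf)
  also have "\<bar>(- 4 * pi\<^sup>2) ^ n * \<dots>\<bar> = w * \<bar>b n - (a - (\<Sum>j<n. c j * b j))\<bar>"
    by (simp add: w_def abs_mult power_abs)
  also have "\<dots> \<le> w * (a * ((1 + u) ^ (2 * n) - 1)
      + (\<Sum>j<n. c j * \<bar>b j\<bar> * ((1 + u) ^ (3 * (n - j) + 2) - 1)))"
    using computed_step_approximates[OF F step n]
    by (intro mult_left_mono)
       (auto simp: approximates_def w_def a_def c_def right_diff_distrib sum_subtractf)
  also have "\<dots> \<le> w * (a * (2 * u * real (2 * n))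
      + (\<Sum>j<n. c j * \<bar>b j\<bar> * (2 * u * real (3 * (n - j) + 2))))"
    using c0 by (intro mult_left_mono add_mono sum_mono growth mult_nonneg_nonneg)
       (auto simp: w_def a_def)
  also have "\<dots> = 2 * u * (w * (a * real (2 * n))
      + (\<Sum>j<n. w * (c j * \<bar>b j\<bar> * real (3 * (n - j) + 2))))"
    by (simp add: distrib_left sum_distrib_left mult_ac del: of_nat_add of_nat_mult)
  also have "\<dots> \<le> 2 * u * (pi\<^sup>2 * G + (\<Sum>j<n. 2 * M * \<bar>cos_fps $ (n - j)\<bar>))"
    using u by (intro mult_left_mono add_mono sum_mono first summand) auto
  also have "\<dots> = 2 * u * (pi\<^sup>2 * G + 2 * M * (\<Sum>j<n. \<bar>cos_fps $ (n - j)\<bar>))"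
    by (simp add: sum_distrib_left)
  also have "\<dots> \<le> 2 * u * (pi\<^sup>2 * G + 2 * M * G)"
    using u \<open>0 \<le> M\<close> cosG by (intro mult_left_mono add_mono) auto
  finally show ?thesis by (simp add: G_def algebra_simps)
qed

text \<open>
  The bound on the residuals presupposes bounded computed values, which in turn needs the error bound itself. Taking
  \<open>u\<close> so small that the error bound for index \<open>k\<close> is below 1 lets both be proved by one induction up to \<open>k\<close>. This
  is where the admissible range of \<open>u\<close> shrinks with \<open>k\<close>, while the constant \<open>K\<close> does not change.
\<close>

lemma computed_scaled_bernoulli_error:
  obtains K where "0 < K" and
    "\<And>k. \<forall>\<^sub>F u in at_right 0. \<forall>b. computed_scaled_bernoulli u b \<longrightarrow>
       \<bar>(- 4 * pi\<^sup>2) ^ k * (b k - scaled_bernoulli k)\<bar> \<le> K * (real k + 1) * u"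
proof -
  define D where "D = (\<lambda>j. (- 4 * pi\<^sup>2) ^ j * scaled_bernoulli j)"
  have "Bseq D"
    unfolding D_def using rescaled_bernoulli_tendsto by (intro convergent_imp_Bseq convergentI)
  then obtain D0 where D0: "0 < D0" "\<And>j. \<bar>D j\<bar> \<le> D0"
    by (auto simp: Bseq_def)
  define A where "A = (\<Sum>i. \<bar>inverse sinc_cofactor $ i\<bar>)"
  define G where "G = (\<Sum>m. \<bar>cos_fps $ m\<bar>)"
  define R where "R = 2 * (pi\<^sup>2 + 2 * (D0 + 1)) * G"
  have "0 < A"
    unfolding A_def using sinc_cofactor_0
    by (intro suminf_pos2[OF summable_abs_inverse_sinc_cofactor, of 0]) auto
  have "0 < G"
    unfolding G_def
    by (intro suminf_pos2[OF summable_abs_cos_fps, of 0]) (auto simp: cos_fps_def)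
  have "0 < R"
    unfolding R_def using \<open>0 < G\<close> D0 by (intro mult_pos_pos add_pos_pos) auto
  show thesis
  proof
    show "0 < A * R" using \<open>0 < A\<close> \<open>0 < R\<close> by simp
    fix k
    \<comment> \<open>The first bound makes \<open>(1 + u) ^ N\<close> linear in \<open>u\<close> for all error counts \<open>N \<le> 5 * k\<close>; the second
      keeps the errors of all values up to index \<open>k\<close> below 1.\<close>
    define \<epsilon> where "\<epsilon> = min (1 / (5 * real k + 1)) (1 / (A * R * (real k + 1)))"
    have "0 < \<epsilon>" unfolding \<epsilon>_def using \<open>0 < A\<close> \<open>0 < R\<close> by (simp add: pos_add_strict)
    have main: "\<bar>(- 4 * pi\<^sup>2) ^ n * (b n - scaled_bernoulli n)\<bar> \<le> A * R * (real n + 1) * u"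
      if u: "0 < u" "u < \<epsilon>" and b: "computed_scaled_bernoulli u b" and n: "n \<le> k" for u b n
      using n
    proof (induction n rule: less_induct)
      case (less n)
      obtain F where F: "computed_factorials u F" and b0: "b 0 = 1"
        and step: "\<And>i. 1 \<le> i \<Longrightarrow> computed_step u F b i (b i)"
        using b unfolding computed_scaled_bernoulli_def by blast
      define E where "E = Abs_fps (\<lambda>j. (- 4 * pi\<^sup>2) ^ j * (b j - scaled_bernoulli j))"
      have "u < 1 / (5 * real k + 1)" "u < 1 / (A * R * (real k + 1))"
        using u unfolding \<epsilon>_def by auto
      then have u5: "u * (5 * real k + 1) < 1" and u1: "A * R * (real k + 1) * u < 1"
        using \<open>0 < A\<close> \<open>0 < R\<close> by (auto simp: pos_less_divide_eq pos_add_strict mult_ac)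
      have small: "\<bar>(- 4 * pi\<^sup>2) ^ j * b j\<bar> \<le> D0 + 1" if j: "j < n" for j
      proof -
        have "\<bar>(- 4 * pi\<^sup>2) ^ j * (b j - scaled_bernoulli j)\<bar> \<le> A * R * (real j + 1) * u"
          using less j by auto
        also have "\<dots> \<le> A * R * (real k + 1) * u"
          using j less.prems u \<open>0 < A\<close> \<open>0 < R\<close> by (intro mult_mono) auto
        finally have "\<bar>(- 4 * pi\<^sup>2) ^ j * b j - D j\<bar> \<le> 1"
          using u1 by (simp add: D_def right_diff_distrib)
        then show ?thesis using D0(2)[of j] by linarith
      qed
      have "\<bar>(sinc_fps * E) $ i\<bar> \<le> R * u" if i: "i \<le> n" for i
      proof (cases "i = 0")
        case True
        have "scaled_bernoulli 0 = 1" using scaled_bernoulli_recurrence[of 0] by simp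
        then show ?thesis using True u b0 \<open>0 < R\<close> by (simp add: E_def)
      next
        case False
        have "real (5 * i) * u \<le> (5 * real k + 1) * u"
          using i less.prems u by (intro mult_right_mono) auto
        then have "real (5 * i) * u \<le> 1" using u5 by (simp add: mult.commute)
        then show ?thesis
          unfolding E_def R_def G_def
          using False i u small by (intro rescaled_residual_le[OF F step]) auto
      qed
      then have "\<bar>E $ n\<bar> \<le> A * ((real n + 1) * (R * u))"
        unfolding A_def by (rule sinc_fps_quotient_le)
      then show ?case by (simp add: E_def mult_ac)
    qed
    show "\<forall>\<^sub>F u in at_right 0. \<forall>b. computed_scaled_bernoulli u b \<longrightarrow>
       \<bar>(- 4 * pi\<^sup>2) ^ k * (b k - scaled_bernoulli k)\<bar> \<le> A * R * (real k + 1) * u"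
      unfolding eventually_at_right_field
      using \<open>0 < \<epsilon>\<close> main by blast
  qed
qed

theorem proposition10p3:
  "\<exists>C :: nat \<Rightarrow> real. C \<in> O(\<lambda>k. real k) \<and>
     (\<forall>k. \<forall>\<^sub>F u in at_right (0 :: real). \<forall>b. computed_scaled_bernoulli u b \<longrightarrow>
        \<bar>(b k - scaled_bernoulli k) / scaled_bernoulli k\<bar> \<le> C k * u)"
proof -
  obtain K where K: "0 < K" and err: "\<And>k. \<forall>\<^sub>F u in at_right 0. \<forall>b. computed_scaled_bernoulli u b \<longrightarrow>
       \<bar>(- 4 * pi\<^sup>2) ^ k * (b k - scaled_bernoulli k)\<bar> \<le> K * (real k + 1) * u"
    using computed_scaled_bernoulli_error by blast
  define D where "D = (\<lambda>k. (- 4 * pi\<^sup>2) ^ k * scaled_bernoulli k)"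
  \<comment> \<open>If \<open>D k = 0\<close>, both the relative error and \<open>C k\<close> are quotients by 0, hence 0; for large \<open>k\<close> this does not
    occur.\<close>
  define C where "C = (\<lambda>k. K * (real k + 1) / \<bar>D k\<bar>)"
  define l where "l = \<bar>\<Sum>n. inverse sinc_cofactor $ n\<bar>"
  have l: "0 < l" unfolding l_def using suminf_inverse_sinc_cofactor_nz by simp
  have "(\<lambda>k. \<bar>D k\<bar>) \<longlonglongrightarrow> l"
    using tendsto_rabs[OF rescaled_bernoulli_tendsto] by (simp add: D_def l_def)
  then have "\<forall>\<^sub>F k in sequentially. l / 2 < \<bar>D k\<bar>"
    using l by (intro order_tendstoD) auto
  then have "\<forall>\<^sub>F k in sequentially. norm (C k) \<le> 4 * K / l * norm (real k)"
    using eventually_ge_at_top[of 1]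
  proof eventually_elim
    case (elim k)
    have "norm (C k) \<le> K * (2 * real k) / (l / 2)"
    proof -
      have "norm (C k) = K * (real k + 1) / \<bar>D k\<bar>"
        using K by (simp add: C_def abs_mult)
      also have "\<dots> \<le> K * (2 * real k) / (l / 2)"
        using elim K l by (intro frac_le mult_left_mono) (auto simp del: less_divide_eq_numeral1 divide_less_eq_numeral1)
      finally show ?thesis .
    qed
    then show ?case by simp
  qed
  then have "C \<in> O(\<lambda>k. real k)" by (rule bigoI)
  moreover have "\<forall>\<^sub>F u in at_right (0 :: real). \<forall>b. computed_scaled_bernoulli u b \<longrightarrow>
        \<bar>(b k - scaled_bernoulli k) / scaled_bernoulli k\<bar> \<le> C k * u" for k
    using err[of k]
  proof eventually_elim
    case (elim u)
    show ?case
    proof (intro allI impI)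
      fix b assume "computed_scaled_bernoulli u b"
      with elim have "\<bar>(- 4 * pi\<^sup>2) ^ k * (b k - scaled_bernoulli k)\<bar> / \<bar>D k\<bar> \<le> K * (real k + 1) * u / \<bar>D k\<bar>"
        by (intro divide_right_mono) auto
      then show "\<bar>(b k - scaled_bernoulli k) / scaled_bernoulli k\<bar> \<le> C k * u"
        by (simp add: C_def D_def abs_mult)
    qed
  qed
  ultimately show ?thesis by blast
qed

end
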